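(* Let $f:\mathbb{R}^n\to\mathbb{R}$ be convex and continuously differentiable, let $g_1,\ldots,g_m:\mathbb{R}^n\to\mathbb{R}$ be continuously differentiable (not necessarily concave), and let $\mathbf{K}:=\{\mathbf{x}\in\mathbb{R}^n : g_j(\mathbf{x})\ge 0,\ j=1,\ldots,m\}$. Assume that: (i) $\mathbf{K}$ is compact and convex; (ii) Slater's condition holds: there exists $\mathbf{x}_0\in\mathbf{K}$ with $g_j(\mathbf{x}_0)>0$ for all $j=1,\ldots,m$; (iii) the nondegeneracy condition holds: for every $j=1,\ldots,m$, $\nabla g_j(\mathbf{x})\neq 0$ for all $\mathbf{x}\in\mathbf{K}$ such that $g_j(\mathbf{x})=0$. For every $\mu>0$, let $\mathbf{x}_\mu\in\mathbf{K}$ be an arbitrary stationary point in $\mathbf{K}$ of the log-barrier function $\phi_\mu$. Then every accumulation point $\mathbf{x}^*\in\mathbf{K}$ of $(\mathbf{x}_\mu)$ as $\mu\to 0$ (that is, every $\mathbf{x}^*$ such that $\mathbf{x}_{\mu_\ell}\to\mathbf{x}^*$ for some sequence $\mu_\ell>0$ with $\mu_\ell\to 0$) is a global minimizer of $f$ on $\mathbf{K}$; and if $\nabla f(\mathbf{x}^* )\neq 0$, then $\mathbf{x}^*$ is a Karush-Kuhn-Tucker (KKT) point of the problem $\mathbf{P}:\ \min_{\mathbf{x}}\{f(\mathbf{x}) : \mathbf{x}\in\mathbf{K}\}$.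
   Context: For $\mu>0$, the log-barrier function $\phi_\mu:\mathbf{K}\to\mathbb{R}\cup\{+\infty\}$ is defined by $\phi_\mu(\mathbf{x}):=f(\mathbf{x})-\mu\sum_{j=1}^m\ln g_j(\mathbf{x})$ if $g_j(\mathbf{x})>0$ for all $j=1,\ldots,m$, and $\phi_\mu(\mathbf{x}):=+\infty$ otherwise. A stationary point of $\phi_\mu$ in $\mathbf{K}$ is a point $\mathbf{x}\in\mathbf{K}$ with $g_j(\mathbf{x})\neq 0$ for all $j=1,\ldots,m$ (hence $g_j(\mathbf{x})>0$ for all $j$) and $\nabla\phi_\mu(\mathbf{x})=0$, i.e. $\nabla f(\mathbf{x})-\sum_{j=1}^m\frac{\mu}{g_j(\mathbf{x})}\nabla g_j(\mathbf{x})=0$. A pair $(\mathbf{x}^*,\lambda)\in\mathbf{K}\times\mathbb{R}^m$ is a KKT point of $\mathbf{P}$ if $\mathbf{x}^*\in\mathbf{K}$, $\lambda\ge 0$ (componentwise), $\lambda_j g_j(\mathbf{x}^* )=0$ for every $j=1,\ldots,m$, and $\nabla f(\mathbf{x}^* )-\sum_{j=1}^m\lambda_j\nabla g_j(\mathbf{x}^* )=0$. The point $\mathbf{x}^*$ is called a KKT point of $\mathbf{P}$ if there exists $\lambda\in\mathbb{R}^m$ such that $(\mathbf{x}^*,\lambda)$ is a KKT point of $\mathbf{P}$. *)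

theory Defs
  imports "HOL-Analysis.Analysis"
begin

text \<open>Only meaningful where \<open>f\<close> is differentiable; elsewhere the value is unspecified.\<close>

definition grad :: "('a::real_inner \<Rightarrow> real) \<Rightarrow> 'a \<Rightarrow> 'a" where
  "grad f x = (THE D. GDERIV f x :> D)"

lemma GDERIV_unique:
  assumes "GDERIV f x :> D" "GDERIV f x :> E"
  shows "D = E"
proof -
  have "(\<lambda>h. h \<bullet> D) = (\<lambda>h. h \<bullet> E)"
    using assms unfolding gderiv_def by (rule has_derivative_unique)
  then have "(D - E) \<bullet> (D - E) = 0"
    by (metis inner_diff_right right_minus_eq)
  then show ?thesis by simp
qed

lemma grad_eqI: "GDERIV f x :> D \<Longrightarrow> grad f x = D"
  unfolding grad_def by (blast intro: GDERIV_unique)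

lemma differentiable_imp_GDERIV_grad:
  fixes f :: "'a::euclidean_space \<Rightarrow> real"
  assumes "f differentiable (at x)"
  shows "GDERIV f x :> grad f x"
proof -
  obtain f' where f': "(f has_derivative f') (at x)"
    using assms unfolding differentiable_def by blast
  interpret linear f' using f' by (rule has_derivative_linear)
  have "f' = (\<lambda>h. h \<bullet> (\<Sum>b\<in>Basis. f' b *\<^sub>R b))"
  proof
    fix h
    have "f' h = f' (\<Sum>b\<in>Basis. (h \<bullet> b) *\<^sub>R b)"
      by (simp add: euclidean_representation)
    also have "\<dots> = h \<bullet> (\<Sum>b\<in>Basis. f' b *\<^sub>R b)"
      by (simp add: sum scale inner_sum_right mult.commute)
    finally show "f' h = h \<bullet> (\<Sum>b\<in>Basis. f' b *\<^sub>R b)" .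
  qed
  then have "GDERIV f x :> (\<Sum>b\<in>Basis. f' b *\<^sub>R b)"
    using f' unfolding gderiv_def by simp
  then show ?thesis using grad_eqI by metis
qed

definition continuously_differentiable :: "('a::euclidean_space \<Rightarrow> real) \<Rightarrow> bool" where
  "continuously_differentiable f \<longleftrightarrow>
     (\<forall>x. f differentiable (at x)) \<and> continuous_on UNIV (grad f)"

definition feasible_set :: "('m \<Rightarrow> 'a \<Rightarrow> real) \<Rightarrow> 'a set" where
  "feasible_set g = {x. \<forall>j. g j x \<ge> 0}"

text \<open>The barrier is defined on the whole space rather than on the feasible set only; outside
  the feasible set some \<open>g j\<close> is negative, so it takes the value \<open>\<infinity>\<close> there.\<close>

definition log_barrier ::
    "('a \<Rightarrow> real) \<Rightarrow> ('m::finite \<Rightarrow> 'a \<Rightarrow> real) \<Rightarrow> real \<Rightarrow> 'a \<Rightarrow> ereal" where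
  "log_barrier f g \<mu> x =
     (if \<forall>j. g j x > 0 then ereal (f x - \<mu> * (\<Sum>j\<in>UNIV. ln (g j x))) else \<infinity>)"

text \<open>If the \<open>g j\<close> are continuous, then the barrier is finite in a neighbourhood of each point
  with all \<open>g j\<close> positive, so \<^const>\<open>real_of_ereal\<close> does not affect the gradient there.\<close>

definition stationary_point ::
    "('a::real_inner \<Rightarrow> real) \<Rightarrow> ('m::finite \<Rightarrow> 'a \<Rightarrow> real) \<Rightarrow> real \<Rightarrow> 'a \<Rightarrow> bool" where
  "stationary_point f g \<mu> x \<longleftrightarrow>
     x \<in> feasible_set g \<and> (\<forall>j. g j x \<noteq> 0) \<and>
     GDERIV (\<lambda>y. real_of_ereal (log_barrier f g \<mu> y)) x :> 0"

lemma stationary_point_iff: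
  fixes f :: "'a::euclidean_space \<Rightarrow> real" and g :: "'m::finite \<Rightarrow> 'a \<Rightarrow> real"
  assumes f: "continuously_differentiable f" and g: "\<And>j. continuously_differentiable (g j)"
  shows "stationary_point f g \<mu> x \<longleftrightarrow>
    x \<in> feasible_set g \<and> (\<forall>j. g j x \<noteq> 0) \<and>
    grad f x - (\<Sum>j\<in>UNIV. (\<mu> / g j x) *\<^sub>R grad (g j) x) = 0"
proof -
  let ?D = "grad f x - (\<Sum>j\<in>UNIV. (\<mu> / g j x) *\<^sub>R grad (g j) x)"
  let ?b = "\<lambda>y. real_of_ereal (log_barrier f g \<mu> y)"
  have "GDERIV ?b x :> ?D" if pos: "\<And>j. g j x > 0"
  proof -
    have df: "(f has_derivative (\<lambda>h. h \<bullet> grad f x)) (at x)"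
      and dg: "\<And>j. (g j has_derivative (\<lambda>h. h \<bullet> grad (g j) x)) (at x)"
      using f g differentiable_imp_GDERIV_grad unfolding continuously_differentiable_def gderiv_def by blast+
    have d: "((\<lambda>y. f y - \<mu> * (\<Sum>j\<in>UNIV. ln (g j y))) has_derivative (\<lambda>h. h \<bullet> ?D)) (at x)"
      by (rule derivative_eq_intros df dg pos refl)+
        (use pos in \<open>auto simp: fun_eq_iff inner_diff_right inner_sum_right sum_distrib_left
           divide_inverse mult.assoc mult.commute mult.left_commute\<close>)
    have "\<forall>\<^sub>F y in nhds x. g j y > 0" for j
    proof -
      have "isCont (g j) x"
        using dg has_derivative_continuous by blast
      then have "(g j \<longlongrightarrow> g j x) (nhds x)"
        by (simp add: continuous_at tendsto_nhds_iff)
      then show ?thesis using pos[of j] by (rule order_tendstoD(1))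
    qed
    then have "\<forall>\<^sub>F y in nhds x. \<forall>j. g j y > 0"
      by (rule eventually_all_finite)
    then have ev: "\<forall>\<^sub>F y in nhds x. f y - \<mu> * (\<Sum>j\<in>UNIV. ln (g j y)) = ?b y"
      by eventually_elim (simp add: log_barrier_def)
    show ?thesis unfolding gderiv_def
      using d ev eventually_nhds_x_imp_x[OF ev]
      by (auto intro: has_derivative_transform_eventually simp: eventually_at_filter eventually_mono)
  qed
  moreover have "g j x > 0" if "x \<in> feasible_set g" "\<forall>j. g j x \<noteq> 0" for j
    using that by (auto simp: feasible_set_def less_le)
  ultimately show ?thesis
    unfolding stationary_point_def by (metis GDERIV_unique)
qed

definition KKT_pair ::
    "('a::real_inner \<Rightarrow> real) \<Rightarrow> ('m::finite \<Rightarrow> 'a \<Rightarrow> real) \<Rightarrow> 'a \<Rightarrow> real ^ 'm \<Rightarrow> bool" where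
  "KKT_pair f g x l \<longleftrightarrow>
     x \<in> feasible_set g \<and> (\<forall>j. l $ j \<ge> 0) \<and> (\<forall>j. l $ j * g j x = 0) \<and>
     grad f x - (\<Sum>j\<in>UNIV. (l $ j) *\<^sub>R grad (g j) x) = 0"

definition KKT_point ::
    "('a::real_inner \<Rightarrow> real) \<Rightarrow> ('m::finite \<Rightarrow> 'a \<Rightarrow> real) \<Rightarrow> 'a \<Rightarrow> bool" where
  "KKT_point f g x \<longleftrightarrow> (\<exists>l. KKT_pair f g x l)"

end

theory Submission
  imports Defs
begin

text \<open>
  The multipliers implicit in the barrier method converge along a subsequence, so every limit of
  stationary points is a KKT point; and although the constraint functions need not be concave,
  convexity of the feasible set \<open>K\<close> makes a KKT point a global minimizer.

  Both steps rest on one observation. If \<open>g j y = 0\<close> at a feasible point \<open>y\<close>, then \<open>g j\<close> is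
  nonnegative, hence cannot decrease initially, along every segment from \<open>y\<close> into \<open>K\<close>. So the
  gradient of \<open>g j\<close> at \<open>y\<close> makes a nonnegative inner product with every direction from \<open>y\<close> into
  \<open>K\<close> (\<open>active_grad_nonneg\<close>). By nondegeneracy this inner product is strictly positive in the
  direction of a Slater point, since such a point may be pushed a little against the gradient
  without leaving \<open>K\<close> (\<open>active_grad_pos\<close>).

  Stationarity of the barrier at \<open>x (\<mu> k)\<close> is the KKT equation with the multipliers
  \<open>\<mu> k / g j (x (\<mu> k))\<close>. For constraints that are inactive in the limit they tend to \<open>0\<close>. Taking
  the inner product of the equation with the direction to the Slater point turns the remaining
  multipliers into nonnegative coefficients of quantities with positive limits, in a sum that
  converges; so these multipliers are bounded (\<open>bounded_multipliers\<close>). Any limit point of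
  the multipliers then satisfies the KKT conditions at \<open>xstar\<close> (\<open>KKT_point_limit\<close>). Finally, the
  tangent inequality for \<open>f\<close> and the nonnegativity of the active gradients give global optimality
  (\<open>KKT_point_imp_is_arg_min\<close>).
\<close>

section \<open>First-order conditions along segments\<close>

lemma deriv_nonneg_of_minimum_at_left_end:
  fixes p :: "real \<Rightarrow> real"
  assumes "(p has_real_derivative c) (at 0)"
    and "\<And>t. \<lbrakk>0 \<le> t; t \<le> 1\<rbrakk> \<Longrightarrow> p 0 \<le> p t"
  shows "0 \<le> c"
proof (rule ccontr)
  assume "\<not> 0 \<le> c"
  then obtain d where d: "d > 0" "\<And>h. \<lbrakk>h > 0; h < d\<rbrakk> \<Longrightarrow> p (0 + h) < p 0"
    using DERIV_neg_dec_right[OF assms(1)] by auto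
  have "p (min (d / 2) 1) < p 0"
    using d(1) d(2)[of "min (d / 2) 1"] by auto
  moreover have "p 0 \<le> p (min (d / 2) 1)"
    using d(1) by (intro assms(2)) auto
  ultimately show False by simp
qed

lemma has_real_derivative_along_line:
  assumes "GDERIV h y :> D"
  shows "((\<lambda>t. h (y + t *\<^sub>R d)) has_real_derivative (d \<bullet> D)) (at 0)"
proof -
  have line: "((\<lambda>t. y + t *\<^sub>R d) has_derivative (\<lambda>t. t *\<^sub>R d)) (at 0)"
    by (auto intro!: derivative_eq_intros)
  have "(h has_derivative (\<lambda>v. v \<bullet> D)) (at (y + 0 *\<^sub>R d))"
    using assms by (simp add: gderiv_def)
  from has_derivative_compose[OF line this] show ?thesis
    by (simp add: has_field_derivative_def mult_commute_abs)
qed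

lemma convex_on_above_tangent_plane:
  assumes "convex_on UNIV f" "GDERIV f y :> D"
  shows "f y + (z - y) \<bullet> D \<le> f z"
proof -
  \<comment> \<open>The gap between chord and graph is nonnegative and vanishes at the left end.\<close>
  let ?p = "\<lambda>t. (1 - t) * f y + t * f z - f (y + t *\<^sub>R (z - y))"
  have "(?p has_real_derivative (f z - f y - (z - y) \<bullet> D)) (at 0)"
    by (rule derivative_eq_intros has_real_derivative_along_line[OF assms(2)] refl)+ simp
  moreover have "?p 0 \<le> ?p t" if "0 \<le> t" "t \<le> 1" for t
    using convex_onD[OF assms(1) that, of y z] by (simp add: algebra_simps)
  ultimately have "0 \<le> f z - f y - (z - y) \<bullet> D"
    by (rule deriv_nonneg_of_minimum_at_left_end)
  then show ?thesis by simp
qed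

section \<open>Active constraints of a convex feasible set\<close>

lemma active_grad_nonneg:
  fixes g :: "'m \<Rightarrow> 'a::euclidean_space \<Rightarrow> real"
  assumes conv: "convex (feasible_set g)"
    and diff: "g j differentiable (at y)"
    and y: "y \<in> feasible_set g" "g j y = 0" and z: "z \<in> feasible_set g"
  shows "0 \<le> (z - y) \<bullet> grad (g j) y"
proof (rule deriv_nonneg_of_minimum_at_left_end)
  show "((\<lambda>t. g j (y + t *\<^sub>R (z - y))) has_real_derivative (z - y) \<bullet> grad (g j) y) (at 0)"
    by (intro has_real_derivative_along_line differentiable_imp_GDERIV_grad diff)
next
  fix t :: real assume "0 \<le> t" "t \<le> 1"
  then have "(1 - t) *\<^sub>R y + t *\<^sub>R z \<in> feasible_set g"
    using conv y(1) z by (auto simp: convex_alt)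
  then have "y + t *\<^sub>R (z - y) \<in> feasible_set g"
    by (simp add: algebra_simps)
  then show "g j (y + 0 *\<^sub>R (z - y)) \<le> g j (y + t *\<^sub>R (z - y))"
    using y(2) by (simp add: feasible_set_def)
qed

lemma Slater_point_interior:
  fixes g :: "'m::finite \<Rightarrow> 'a::topological_space \<Rightarrow> real"
  assumes "\<And>j. continuous_on UNIV (g j)" "\<And>j. g j x0 > 0"
  shows "x0 \<in> interior (feasible_set g)"
proof (rule interiorI)
  have "open (\<Inter>j. {y. 0 < g j y})"
    using assms(1) by (intro open_INT ballI open_Collect_less continuous_on_const) auto
  then show "open {y. \<forall>j. 0 < g j y}"
    by (simp add: INTER_eq)
qed (use assms(2) in \<open>auto simp: feasible_set_def less_imp_le\<close>)

text \<open>
  Stepping from \<open>x0\<close> against the gradient by a small multiple stays in the feasible set and lowers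
  the inner product by a positive amount, while it remains nonnegative.
\<close>

lemma active_grad_pos:
  fixes g :: "'m \<Rightarrow> 'a::euclidean_space \<Rightarrow> real"
  assumes "convex (feasible_set g)" "g j differentiable (at y)"
    and "y \<in> feasible_set g" "g j y = 0" "grad (g j) y \<noteq> 0"
    and "x0 \<in> interior (feasible_set g)"
  shows "0 < (x0 - y) \<bullet> grad (g j) y"
proof -
  let ?D = "grad (g j) y"
  obtain e where e: "e > 0" "cball x0 e \<subseteq> feasible_set g"
    using assms(6) by (auto simp: mem_interior_cball)
  let ?s = "e / norm ?D"
  have "x0 - ?s *\<^sub>R ?D \<in> cball x0 e"
    using e(1) assms(5) by (simp add: dist_norm)
  then have "0 \<le> (x0 - ?s *\<^sub>R ?D - y) \<bullet> ?D"
    using e(2) assms(1-4) by (intro active_grad_nonneg) auto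
  also have "\<dots> = (x0 - y) \<bullet> ?D - ?s * (?D \<bullet> ?D)"
    by (simp add: inner_diff_left)
  also have "\<dots> < (x0 - y) \<bullet> ?D"
    using e(1) assms(5) by simp
  finally show ?thesis .
qed

section \<open>Sufficiency of the KKT conditions\<close>

text \<open>
  By complementarity only active constraints contribute to the gradient of \<open>f\<close>, which therefore
  makes a nonnegative inner product with every direction into the feasible set.
\<close>

lemma KKT_point_imp_is_arg_min:
  fixes f :: "'a::euclidean_space \<Rightarrow> real" and g :: "'m::finite \<Rightarrow> 'a \<Rightarrow> real"
  assumes f: "convex_on UNIV f" "f differentiable (at y)"
    and g: "\<And>j. g j differentiable (at y)"
    and conv: "convex (feasible_set g)"
    and KKT: "KKT_point f g y"
  shows "is_arg_min f (\<lambda>z. z \<in> feasible_set g) y"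
proof -
  obtain l where "KKT_pair f g y l"
    using KKT by (auto simp: KKT_point_def)
  then have y: "y \<in> feasible_set g" and l: "\<And>j. l $ j \<ge> 0" "\<And>j. l $ j * g j y = 0"
    and stat: "grad f y = (\<Sum>j\<in>UNIV. (l $ j) *\<^sub>R grad (g j) y)"
    by (auto simp: KKT_pair_def)
  have "f y \<le> f z" if z: "z \<in> feasible_set g" for z
  proof -
    have "0 \<le> l $ j * ((z - y) \<bullet> grad (g j) y)" for j
    proof (cases "l $ j = 0")
      case False
      then have "g j y = 0" using l(2)[of j] by simp
      then show ?thesis
        using active_grad_nonneg[OF conv g y _ z] l(1) by simp
    qed simp
    then have "0 \<le> (z - y) \<bullet> grad f y"
      by (simp add: stat inner_sum_right sum_nonneg)
    also have "f y + \<dots> \<le> f z"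
      by (intro convex_on_above_tangent_plane f differentiable_imp_GDERIV_grad)
    finally show ?thesis by simp
  qed
  then show ?thesis using y by (auto simp: is_arg_min_linorder)
qed

section \<open>Boundedness and convergence of the multipliers\<close>

text \<open>
  Eventually all summands are nonnegative, so none can grow without the sum growing; and the weight
  of \<open>l i\<close> stays away from \<open>0\<close>.
\<close>

lemma bounded_multipliers:
  fixes l p :: "'i \<Rightarrow> nat \<Rightarrow> real"
  assumes "finite J" "i \<in> J"
    and l: "\<And>j k. j \<in> J \<Longrightarrow> 0 \<le> l j k"
    and p: "\<And>j. j \<in> J \<Longrightarrow> p j \<longlonglongrightarrow> P j" "\<And>j. j \<in> J \<Longrightarrow> P j > 0"
    and bdd: "Bseq (\<lambda>k. \<Sum>j\<in>J. l j k * p j k)"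
  shows "Bseq (l i)"
proof -
  obtain B where B: "B > 0" "\<And>k. norm (\<Sum>j\<in>J. l j k * p j k) \<le> B"
    using bdd by (auto simp: Bseq_def)
  have "\<forall>\<^sub>F k in sequentially. \<forall>j\<in>J. p j k > P j / 2"
    using p by (intro eventually_ball_finite[OF assms(1)] ballI order_tendstoD(1)) auto
  then have "\<forall>\<^sub>F k in sequentially. norm (l i k) \<le> B / (P i / 2)"
  proof eventually_elim
    case (elim k)
    have nonneg: "0 \<le> l j k * p j k" if "j \<in> J" for j
      using elim p(2)[OF that] l[OF that] that by (intro mult_nonneg_nonneg) (auto dest!: bspec)
    have "l i k * (P i / 2) \<le> l i k * p i k"
      using elim assms(2) l by (intro mult_left_mono) auto
    also have "\<dots> \<le> (\<Sum>j\<in>J. l j k * p j k)"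
      using nonneg assms(1,2) by (intro member_le_sum) auto
    also have "\<dots> \<le> B"
      using B(2)[of k] by simp
    finally show ?case
      using p(2)[OF assms(2)] l[OF assms(2)] by (simp add: field_simps)
  qed
  then show ?thesis by (rule BfunI)
qed

lemma convergent_subsequence_vec:
  fixes l :: "'m::finite \<Rightarrow> nat \<Rightarrow> real"
  assumes "\<And>j. Bseq (l j)"
  obtains L :: "real ^ 'm" and r :: "nat \<Rightarrow> nat"
  where "strict_mono r" "\<And>j. (\<lambda>k. l j (r k)) \<longlonglongrightarrow> L $ j"
proof -
  have "\<exists>B. \<forall>k. \<bar>l j k\<bar> \<le> B" for j
    using assms[of j] by (auto simp: Bseq_def)
  then obtain B where B: "\<And>j k. \<bar>l j k\<bar> \<le> B j" by metis
  have "norm (\<chi> j. l j k) \<le> (\<Sum>j\<in>UNIV. B j)" for k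
    using norm_le_l1_cart[of "\<chi> j. l j k"] sum_mono[of UNIV "\<lambda>j. \<bar>l j k\<bar>" B] B
    by fastforce
  then have "bounded (range (\<lambda>k. \<chi> j. l j k))"
    by (auto simp: bounded_iff)
  then obtain L r where "strict_mono r" "((\<lambda>k. \<chi> j. l j k) \<circ> r) \<longlonglongrightarrow> L"
    using bounded_imp_convergent_subsequence by blast
  then show thesis
    using that[of r L] tendsto_vec_nth[of "(\<lambda>k. \<chi> j. l j k) \<circ> r" L sequentially]
    by (simp add: o_def)
qed

lemma tendsto_grad_compose:
  assumes "continuously_differentiable h" "X \<longlonglongrightarrow> y"
  shows "(\<lambda>k. grad h (X k)) \<longlonglongrightarrow> grad h y"
  using assms by (auto simp: continuously_differentiable_def intro: continuous_on_tendsto_compose)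

lemma continuously_differentiable_imp_continuous_on:
  assumes "continuously_differentiable h"
  shows "continuous_on UNIV h"
  using assms
  by (auto simp: continuously_differentiable_def intro!: differentiable_imp_continuous_on
      differentiable_at_imp_differentiable_on)

text \<open>
  Nondegeneracy and the Slater point serve to keep the multipliers of the constraints that are
  active at the limit from escaping to infinity; everything else is continuity.
\<close>

lemma KKT_point_limit:
  fixes f :: "'a::euclidean_space \<Rightarrow> real" and g :: "'m::finite \<Rightarrow> 'a \<Rightarrow> real"
  assumes f: "continuously_differentiable f" and g: "\<And>j. continuously_differentiable (g j)"
    and conv: "convex (feasible_set g)"
    and Slater: "\<And>j. g j x0 > 0"
    and nondeg: "\<And>j. g j y = 0 \<Longrightarrow> grad (g j) y \<noteq> 0"
    and stat: "\<And>k. stationary_point f g (\<mu> k) (X k)"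
    and \<mu>: "\<And>k. \<mu> k > 0" "\<mu> \<longlonglongrightarrow> 0"
    and X: "X \<longlonglongrightarrow> y"
  shows "KKT_point f g y"
proof -
  have cont: "continuous_on UNIV (g j)" for j
    using g by (rule continuously_differentiable_imp_continuous_on)
  have gX: "(\<lambda>k. g j (X k)) \<longlonglongrightarrow> g j y" for j
    using continuous_on_tendsto_compose[OF cont X] by simp
  have gX_pos: "g j (X k) > 0" for j k
    using stat[of k] by (auto simp: stationary_point_def feasible_set_def less_le)
  have y: "y \<in> feasible_set g"
    using LIMSEQ_le_const[OF gX] gX_pos by (auto simp: feasible_set_def less_imp_le)

  define l where "l = (\<lambda>j k. \<mu> k / g j (X k))"
  have l_pos: "l j k > 0" for j k
    using \<mu> gX_pos by (simp add: l_def)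
  have stat_eq: "grad f (X k) = (\<Sum>j\<in>UNIV. l j k *\<^sub>R grad (g j) (X k))" for k
    using stat[of k] by (simp add: stationary_point_iff[OF f g] l_def)
  have inactive: "l j \<longlonglongrightarrow> 0" if "g j y \<noteq> 0" for j
    unfolding l_def using tendsto_divide[OF \<mu>(2) gX that] by simp

  define p where "p = (\<lambda>j k. (x0 - X k) \<bullet> grad (g j) (X k))"
  have p_lim: "p j \<longlonglongrightarrow> (x0 - y) \<bullet> grad (g j) y" for j
    unfolding p_def by (intro tendsto_intros X tendsto_grad_compose g)
  let ?A = "{j. g j y = 0}"
  have x0: "x0 \<in> interior (feasible_set g)"
    by (intro Slater_point_interior cont Slater)
  have p_pos: "(x0 - y) \<bullet> grad (g j) y > 0" if "j \<in> ?A" for j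
    using that g nondeg
    by (intro active_grad_pos conv y x0) (auto simp: continuously_differentiable_def)
  have "(\<Sum>j\<in>?A. l j k * p j k)
      = (x0 - X k) \<bullet> grad f (X k) - (\<Sum>j\<in>- ?A. l j k * p j k)" for k
  proof -
    have "(x0 - X k) \<bullet> grad f (X k) = (\<Sum>j\<in>UNIV. l j k * p j k)"
      by (simp add: stat_eq inner_sum_right p_def)
    also have "\<dots> = (\<Sum>j\<in>?A. l j k * p j k) + (\<Sum>j\<in>- ?A. l j k * p j k)"
      using sum.Int_Diff[of UNIV "\<lambda>j. l j k * p j k" ?A] by (simp add: Compl_eq_Diff_UNIV)
    finally show ?thesis by simp
  qed
  moreover have "(\<lambda>k. (x0 - X k) \<bullet> grad f (X k) - (\<Sum>j\<in>- ?A. l j k * p j k))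
      \<longlonglongrightarrow> (x0 - y) \<bullet> grad f y - (\<Sum>j\<in>- ?A. 0 * ((x0 - y) \<bullet> grad (g j) y))"
    by (intro tendsto_intros X tendsto_grad_compose f p_lim inactive) simp
  ultimately have "Bseq (\<lambda>k. \<Sum>j\<in>?A. l j k * p j k)"
    by (metis (no_types, lifting) convergentI convergent_imp_Bseq ext)
  then have active: "Bseq (l j)" if "g j y = 0" for j
    using that l_pos p_lim p_pos by (intro bounded_multipliers[where J = ?A]) (auto intro: less_imp_le)
  have "Bseq (l j)" for j
    using active inactive convergentI convergent_imp_Bseq by blast
  then obtain L :: "real ^ 'm" and r
    where r: "strict_mono r" and L: "\<And>j. (\<lambda>k. l j (r k)) \<longlonglongrightarrow> L $ j"
    using convergent_subsequence_vec by blast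

  have Xr: "(\<lambda>k. X (r k)) \<longlonglongrightarrow> y"
    using LIMSEQ_subseq_LIMSEQ[OF X r] by (simp add: o_def)
  have "KKT_pair f g y L"
    unfolding KKT_pair_def
  proof (intro conjI allI y)
    show "L $ j \<ge> 0" for j
      using LIMSEQ_le_const[OF L] l_pos by (auto simp: less_imp_le)
    show "L $ j * g j y = 0" for j
    proof (cases "g j y = 0")
      case False
      then have "(\<lambda>k. l j (r k)) \<longlonglongrightarrow> 0"
        using LIMSEQ_subseq_LIMSEQ[OF inactive r] by (simp add: o_def)
      then show ?thesis using L LIMSEQ_unique by fastforce
    qed simp
    have "(\<lambda>k. grad f (X (r k))) \<longlonglongrightarrow> grad f y"
      using f Xr by (rule tendsto_grad_compose)
    moreover have "(\<lambda>k. grad f (X (r k))) \<longlonglongrightarrow> (\<Sum>j\<in>UNIV. (L $ j) *\<^sub>R grad (g j) y)"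
      unfolding stat_eq by (intro tendsto_intros L tendsto_grad_compose g Xr)
    ultimately show "grad f y - (\<Sum>j\<in>UNIV. (L $ j) *\<^sub>R grad (g j) y) = 0"
      using LIMSEQ_unique by fastforce
  qed
  then show ?thesis by (auto simp: KKT_point_def)
qed

section \<open>Convergence of the log-barrier method\<close>

theorem theorem3:
  fixes f :: "real ^ 'n \<Rightarrow> real"
    and g :: "'m::finite \<Rightarrow> real ^ 'n \<Rightarrow> real"
    and x :: "real \<Rightarrow> real ^ 'n"
    and xstar :: "real ^ 'n"
    and \<mu> :: "nat \<Rightarrow> real"
  assumes "convex_on UNIV f"
    and "continuously_differentiable f"
    and "\<And>j. continuously_differentiable (g j)"
    and "compact (feasible_set g)"
    and "convex (feasible_set g)"
    and Slater: "\<exists>x0 \<in> feasible_set g. \<forall>j. g j x0 > 0"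
    and nondegenerate: "\<And>j y. \<lbrakk>y \<in> feasible_set g; g j y = 0\<rbrakk> \<Longrightarrow> grad (g j) y \<noteq> 0"
    and stationary: "\<And>t. t > 0 \<Longrightarrow> stationary_point f g t (x t)"
    and "\<And>k. \<mu> k > 0"
    and "\<mu> \<longlonglongrightarrow> 0"
    and "(\<lambda>k. x (\<mu> k)) \<longlonglongrightarrow> xstar"
  shows "is_arg_min f (\<lambda>y. y \<in> feasible_set g) xstar
    \<and> (grad f xstar \<noteq> 0 \<longrightarrow> KKT_point f g xstar)"
proof -
  note f = assms(2) and g = assms(3)
  obtain x0 where x0: "\<And>j. g j x0 > 0" using Slater by blast
  have "xstar \<in> feasible_set g"
  proof (rule closed_sequentially[OF compact_imp_closed[OF assms(4)] _ assms(11)])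
    show "x (\<mu> k) \<in> feasible_set g" for k
      using stationary[OF assms(9)] by (simp add: stationary_point_def)
  qed
  then have KKT: "KKT_point f g xstar"
    using assms(9) by (intro KKT_point_limit[OF f g assms(5) x0 _ _ _ assms(10,11)]
        nondegenerate stationary) auto
  moreover have "is_arg_min f (\<lambda>y. y \<in> feasible_set g) xstar"
    using f g by (intro KKT_point_imp_is_arg_min assms(1,5) KKT)
      (auto simp: continuously_differentiable_def)
  ultimately show ?thesis by blast
qed

end
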